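(* In the asymptotic setting described in the context with $\mu\le Q$, let $\kappa=\lfloor Q/\mu\rfloor$ and $\alpha=Q/(\mu\kappa)\in[1,2)$. For each policy $\pi\in\{\text{DTD},\text{OR}\}$, the optimal value $V^{E,\pi}_n(X)$ of the VRPSD with expected capacity constraints on the first $n$ customers satisfies $$\alpha\cdot\frac{2\mu\bar d}{Q}\le\liminf_{n\to\infty}\frac{V^{E,\pi}_n(X)}{n}\le\limsup_{n\to\infty}\frac{V^{E,\pi}_n(X)}{n}\le(\alpha+1)\cdot\frac{2\mu\bar d}{Q}\qquad\text{almost surely.}$$
   Context: **Setting.** Let $\mathcal{R}\subset\mathbb{R}^2$ be compact, and let $(X_i,\xi_i)_{i\ge1}$ be i.i.d. random variables on $\mathcal{R}\times\mathbb{R}_{\ge0}$, with $\xi_i$ (demand of customer $i$) independent of $X_i$ (location of customer $i$). $Q>0$ is the vehicle capacity, $\mu=\mathbb{E}[\xi_i]\in(0,\infty)$, $\bar d=\mathbb{E}\|X_i\|\in(0,\infty)$ (Euclidean norm). The depot $0$ is at the origin $X_0$. Travel costs are $c_{i,j}=\|X_i-X_j\|$; failure cost $c^F_i=2\|X_i\|$; preventive return cost $c^P_{i,j}=\|X_i\|+\|X_j\|-\|X_i-X_j\|$ (no penalty terms; $c^P_{0,j}=0$). **Routes and recourse (conditional on locations; expectations below are over demands only).** A path is a nonempty sequence $p=(i_1,\dots,i_t)$ of distinct customers; with $i_0=i_{t+1}=0$, $L(p)=\sum_{j=0}^t\|X_{i_j}-X_{i_{j+1}}\|$. - DTD (detour-to-depot):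 $\bar{\mathcal{Q}}^{\text{DTD}}_p=\sum_{j=1}^t\sum_{l\ge1}\mathbb{P}\left[\sum_{k<j}\xi_{i_k}\le lQ<\sum_{k\le j}\xi_{i_k}\right]c^F_{i_j}$. - OR (optimal restocking): with $\Psi(s,q)=\max\{\lceil(s-q)/Q\rceil,0\}$ and $q\in[0,Q]$, set $F^p_{i_t}(q)=0$ and, for $j<t$, $F^p_{i_j}(q)=\min\{H^p_{i_{j+1}}(q),c^P_{i_j,i_{j+1}}+H^p_{i_{j+1}}(Q)\}$, where $H^p_i(q)=\mathbb{E}[c^F_i\Psi(\xi_i,q)+F^p_i(\Psi(\xi_i,q)Q+q-\xi_i)]$; $\bar{\mathcal{Q}}^{\text{OR}}_p=F^p_{i_0}(Q)$. $\mathcal{Q}^\pi_p$ is the minimum of $\bar{\mathcal{Q}}^\pi$ over $p$ and its reversal. **ECC-VRPSD.** The expected capacity constraints (ECCs) require the total expected demand on each route to be at most $Q$, i.e., each route serves at most $\kappa=\lfloor Q/\mu\rfloor$ customers. $V^{E,\pi}_n(X)$ is the minimum, over all partitions of $\{1,\dots,n\}$ into any number of paths each containing at most $\kappa$ customers, of $\sum_p(L(p)+\mathcal{Q}^\pi_p)$. *)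

theory Defs
  imports "HOL-Probability.Probability"
begin

text \<open>
  Throughout, \<open>x i\<close> is the location of customer \<open>i \<ge> 1\<close> and \<open>x 0\<close> that of the depot, which is the
  origin. Locations are deterministic in this theory: probabilities and expectations are taken over
  the demands \<open>\<xi> i\<close> (random variables on \<open>M\<close>) only. A path is a list of customers, without the
  depot at its ends.
\<close>

type_synonym point = "real ^ 2"

datatype policy = Detour_To_Depot | Optimal_Restocking

definition route_length :: "(nat \<Rightarrow> point) \<Rightarrow> nat list \<Rightarrow> real" where
  "route_length x p =
     (let r = 0 # p @ [0] in \<Sum>j\<le>length p. norm (x (r ! j) - x (r ! Suc j)))"

definition failure_cost :: "(nat \<Rightarrow> point) \<Rightarrow> nat \<Rightarrow> real" where
  "failure_cost x i = 2 * norm (x i)"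

text \<open>This vanishes for \<open>i = 0\<close>, since \<open>x 0\<close> is the origin.\<close>

definition preventive_cost :: "(nat \<Rightarrow> point) \<Rightarrow> nat \<Rightarrow> nat \<Rightarrow> real" where
  "preventive_cost x i j = norm (x i) + norm (x j) - norm (x i - x j)"

text \<open>The inner series over \<open>l \<ge> 1\<close> is indexed from 0, whence \<open>Suc l\<close>; positions in the path
  are numbered from 0.\<close>

definition dtd_cost ::
  "'w measure \<Rightarrow> (nat \<Rightarrow> 'w \<Rightarrow> real) \<Rightarrow> real \<Rightarrow> (nat \<Rightarrow> point) \<Rightarrow> nat list \<Rightarrow> real" where
  "dtd_cost M \<xi> Q x p =
     (\<Sum>j<length p.
        (\<Sum>l. measure M {\<omega> \<in> space M. (\<Sum>k<j. \<xi> (p ! k) \<omega>) \<le> real (Suc l) * Q \<and>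
                                   real (Suc l) * Q < (\<Sum>k\<le>j. \<xi> (p ! k) \<omega>)}
             * failure_cost x (p ! j)))"

definition num_failures :: "real \<Rightarrow> real \<Rightarrow> real \<Rightarrow> int" where
  "num_failures Q s q = max \<lceil>(s - q) / Q\<rceil> 0"

text \<open>Expected cost of serving \<open>i\<close> when arriving there with residual load \<open>q\<close>, given the
  cost-to-go \<open>F\<close> (a function of the residual load) after \<open>i\<close> has been served.\<close>

definition serve_cost ::
  "'w measure \<Rightarrow> (nat \<Rightarrow> 'w \<Rightarrow> real) \<Rightarrow> real \<Rightarrow> (nat \<Rightarrow> point) \<Rightarrow> nat \<Rightarrow> (real \<Rightarrow> real) \<Rightarrow> real \<Rightarrow> real" where
  "serve_cost M \<xi> Q x i F q =
     (\<integral>\<omega>. (let \<psi> = real_of_int (num_failures Q (\<xi> i \<omega>) q)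
           in failure_cost x i * \<psi> + F (\<psi> * Q + q - \<xi> i \<omega>)) \<partial>M)"

text \<open>\<open>cost_to_go M \<xi> Q x i js q\<close> is the optimal expected cost after serving \<open>i\<close> (or leaving the
  depot, if \<open>i = 0\<close>) with residual load \<open>q\<close>, when the customers \<open>js\<close> are still to be visited in this
  order.\<close>

fun cost_to_go ::
  "'w measure \<Rightarrow> (nat \<Rightarrow> 'w \<Rightarrow> real) \<Rightarrow> real \<Rightarrow> (nat \<Rightarrow> point) \<Rightarrow> nat \<Rightarrow> nat list \<Rightarrow> (real \<Rightarrow> real)" where
  "cost_to_go M \<xi> Q x i [] = (\<lambda>q. 0)"
| "cost_to_go M \<xi> Q x i (j # js) =
     (\<lambda>q. min (serve_cost M \<xi> Q x j (cost_to_go M \<xi> Q x j js) q)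
              (preventive_cost x i j + serve_cost M \<xi> Q x j (cost_to_go M \<xi> Q x j js) Q))"

definition or_cost ::
  "'w measure \<Rightarrow> (nat \<Rightarrow> 'w \<Rightarrow> real) \<Rightarrow> real \<Rightarrow> (nat \<Rightarrow> point) \<Rightarrow> nat list \<Rightarrow> real" where
  "or_cost M \<xi> Q x p = cost_to_go M \<xi> Q x 0 p Q"

fun directed_recourse_cost ::
  "policy \<Rightarrow> 'w measure \<Rightarrow> (nat \<Rightarrow> 'w \<Rightarrow> real) \<Rightarrow> real \<Rightarrow> (nat \<Rightarrow> point) \<Rightarrow> nat list \<Rightarrow> real" where
  "directed_recourse_cost Detour_To_Depot = dtd_cost"
| "directed_recourse_cost Optimal_Restocking = or_cost"

definition recourse_cost ::
  "policy \<Rightarrow> 'w measure \<Rightarrow> (nat \<Rightarrow> 'w \<Rightarrow> real) \<Rightarrow> real \<Rightarrow> (nat \<Rightarrow> point) \<Rightarrow> nat list \<Rightarrow> real" where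
  "recourse_cost \<pi> M \<xi> Q x p =
     min (directed_recourse_cost \<pi> M \<xi> Q x p) (directed_recourse_cost \<pi> M \<xi> Q x (rev p))"

definition ecc_plans :: "nat \<Rightarrow> nat \<Rightarrow> nat list set set" where
  "ecc_plans \<kappa> n =
     {P. (\<forall>p\<in>P. p \<noteq> [] \<and> distinct p \<and> length p \<le> \<kappa>) \<and>
         disjoint_family_on set P \<and> (\<Union>p\<in>P. set p) = {1..n}}"

definition ecc_opt ::
  "policy \<Rightarrow> 'w measure \<Rightarrow> (nat \<Rightarrow> 'w \<Rightarrow> real) \<Rightarrow> real \<Rightarrow> nat \<Rightarrow> (nat \<Rightarrow> point) \<Rightarrow> nat \<Rightarrow> real" where
  "ecc_opt \<pi> M \<xi> Q \<kappa> x n =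
     Min ((\<lambda>P. \<Sum>p\<in>P. route_length x p + recourse_cost \<pi> M \<xi> Q x p) ` ecc_plans \<kappa> n)"

text \<open>The minimum above is over a finite nonempty set.\<close>

lemma finite_ecc_plans: "finite (ecc_plans \<kappa> n)"
proof (rule finite_subset)
  show "ecc_plans \<kappa> n \<subseteq> Pow {p. set p \<subseteq> {1..n} \<and> length p \<le> \<kappa>}"
    unfolding ecc_plans_def by fastforce
  show "finite (Pow {p. set p \<subseteq> {1..n} \<and> length p \<le> \<kappa>})"
    using finite_lists_length_le[of "{1..n}" \<kappa>] by simp
qed

lemma ecc_plans_nonempty: "\<kappa> \<ge> 1 \<Longrightarrow> ecc_plans \<kappa> n \<noteq> {}"
proof -
  assume "\<kappa> \<ge> 1"
  then have "(\<lambda>i. [i]) ` {1..n} \<in> ecc_plans \<kappa> n"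
    by (auto simp: ecc_plans_def disjoint_family_on_def)
  then show ?thesis by blast
qed

end

theory Submission imports Defs begin

text \<open>
  Every route is at least twice as long as the distance from the depot to each of its at most \<open>\<kappa>\<close>
  customers, hence at least \<open>2 / \<kappa>\<close> times the sum of these distances; recourse costs are nonnegative.
  For the upper bound, cover \<open>R\<close> by finitely many balls of radius \<open>\<epsilon>\<close> and serve the customers of each
  ball in groups of exactly \<open>\<kappa>\<close>, with at most one smaller group per ball. Up to \<open>O(\<epsilon>)\<close> per customer, a
  full group is then visited at the cost of the lower bound, and under either policy its expected
  number of failures is at most its expected demand divided by \<open>Q\<close>, which accounts for the additional
  \<open>2 \<mu> d / Q\<close>. The averages of the distances converge by the strong law of large numbers, which for
  bounded variables follows from Hoeffding's inequality and the Borel--Cantelli lemma.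
\<close>

subsection \<open>Strong law of large numbers for bounded variables\<close>


text \<open>For a fixed tolerance the Hoeffding bound decays geometrically in \<open>n\<close>,
  hence is summable, and Borel-Cantelli leaves only finitely many large deviations almost surely.
  The family starts at index 1 because index 0 belongs to the depot.\<close>

lemma (in prob_space) strong_law_bounded:
  fixes Y :: "nat \<Rightarrow> 'a \<Rightarrow> real"
  assumes indep: "indep_vars (\<lambda>_. borel) Y {1..}"
    and distr: "\<And>i. i \<ge> 1 \<Longrightarrow> distr M borel (Y i) = distr M borel (Y 1)"
    and bnd: "\<And>\<omega>. \<omega> \<in> space M \<Longrightarrow> Y 1 \<omega> \<in> {a..b}" and "a < b"
  shows "AE \<omega> in M. (\<lambda>n. (\<Sum>i\<in>{1..n}. Y i \<omega>) / real n) \<longlonglongrightarrow> expectation (Y 1)"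
proof -
  let ?S = "\<lambda>n \<omega>. (\<Sum>i\<in>{1..n}. Y i \<omega>)"
  have rv [measurable]: "Y i \<in> borel_measurable M" if "i \<ge> 1" for i
    using indep that by (auto simp: indep_vars_def)
  have dev: "prob {\<omega>\<in>space M. \<bar>?S n \<omega> / real n - expectation (Y 1)\<bar> \<ge> \<epsilon>}
      \<le> 2 * exp (-2 * \<epsilon>\<^sup>2 / (b - a)\<^sup>2) ^ n" if "\<epsilon> > 0" "n \<ge> 1" for \<epsilon> n
  proof -
    interpret Hoeffding_ineq_iid M "{1..n}" Y "Y 1" a b "expectation (Y 1)"
    proof unfold_locales
      show "indep_vars (\<lambda>_. borel) Y {1..n}"
        by (rule indep_vars_subset[OF indep]) auto
      show "distr M borel (Y i) = distr M borel (Y 1)" if "i \<in> {1..n}" for i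
        using that by (intro distr) simp
    qed (use bnd rv[of 1] in simp_all)
    have "exp (-2 * real n * \<epsilon>\<^sup>2 / (b - a)\<^sup>2) = exp (-2 * \<epsilon>\<^sup>2 / (b - a)\<^sup>2) ^ n"
      unfolding exp_of_nat_mult[symmetric] by simp
    then show ?thesis
      using Hoeffding_ineq_abs_ge'[of \<epsilon>] that \<open>a < b\<close> by (simp del: expectation_X)
  qed
  have "AE \<omega> in M. eventually (\<lambda>n. \<bar>?S n \<omega> / real n - expectation (Y 1)\<bar> < \<epsilon>) sequentially"
    if "\<epsilon> > 0" for \<epsilon>
  proof -
    let ?A = "\<lambda>n. {\<omega>\<in>space M. \<bar>?S n \<omega> / real n - expectation (Y 1)\<bar> \<ge> \<epsilon>}"
    have "{\<omega>\<in>space M. \<bar>f \<omega> / real n - c\<bar> \<ge> \<epsilon>} \<in> sets M"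
      if [measurable]: "f \<in> borel_measurable M" for f :: "'a \<Rightarrow> real" and n c
      by measurable
    moreover have "?S n \<in> borel_measurable M" for n
      by (intro borel_measurable_sum rv) auto
    ultimately have meas: "?A n \<in> sets M" for n
      by blast
    have "summable (\<lambda>n. exp (-2 * \<epsilon>\<^sup>2 / (b - a)\<^sup>2) ^ n)"
      using that \<open>a < b\<close> by (intro summable_geometric) (auto simp: divide_neg_pos)
    then have "summable (\<lambda>n. 2 * exp (-2 * \<epsilon>\<^sup>2 / (b - a)\<^sup>2) ^ n)"
      by (rule summable_mult)
    then have "summable (\<lambda>n. prob (?A n))"
      by (rule summable_comparison_test'[where N = 1]) (use dev that in auto)
    then have "AE \<omega> in M. eventually (\<lambda>n. \<omega> \<in> space M - ?A n) sequentially"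
      by (intro borel_cantelli_AE1 meas) (auto simp: less_top[symmetric])
    then show ?thesis
      by eventually_elim (auto elim: eventually_mono)
  qed
  \<comment> \<open>Countably many tolerances suffice, so one null set serves for all of
    them.\<close>
  then have "AE \<omega> in M. \<forall>k. eventually (\<lambda>n. \<bar>?S n \<omega> / real n - expectation (Y 1)\<bar> < inverse (real (Suc k))) sequentially"
    by (simp add: AE_all_countable)
  then show ?thesis
  proof eventually_elim
    case (elim \<omega>)
    show ?case
    proof (rule tendstoI)
      fix e :: real assume "e > 0"
      then obtain k where "inverse (real (Suc k)) < e"
        using reals_Archimedean by blast
      with elim[rule_format, of k]
      show "eventually (\<lambda>n. dist (?S n \<omega> / real n) (expectation (Y 1)) < e) sequentially"
        by (auto simp: dist_real_def elim: eventually_mono)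
    qed
  qed
qed

subsection \<open>Route lengths and grouping of customers\<close>

lemma sum_lessThan_nth:
  fixes h :: "'b \<Rightarrow> real"
  shows "(\<Sum>j<length xs. h (xs ! j)) = sum_list (map h xs)"
  by (simp add: sum_list_sum_nth atLeast0LessThan)

text \<open>The legs of the closed tour start once at the depot and once at each position of
  \<open>p\<close>, and they end at the same points.\<close>

lemma sum_route_nth:
  fixes h :: "nat \<Rightarrow> real"
  shows "(\<Sum>j\<le>length p. h ((0 # p @ [0]) ! j)) = h 0 + sum_list (map h p)"
    and "(\<Sum>j\<le>length p. h ((0 # p @ [0]) ! Suc j)) = h 0 + sum_list (map h p)"
proof -
  have "(0 # p @ [0]) ! j = (0 # p) ! j" if "j \<le> length p" for j
    using that by (auto simp: nth_Cons nth_append split: nat.split)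
  then show "(\<Sum>j\<le>length p. h ((0 # p @ [0]) ! j)) = h 0 + sum_list (map h p)"
    using sum_lessThan_nth[of h "0 # p"] by (simp add: lessThan_Suc_atMost)
  show "(\<Sum>j\<le>length p. h ((0 # p @ [0]) ! Suc j)) = h 0 + sum_list (map h p)"
    using sum_lessThan_nth[of h "p @ [0]"] by (simp add: lessThan_Suc_atMost)
qed

text \<open>Each leg is replaced by the detour through \<open>c\<close>. Every customer is an
  endpoint of two legs, and the depot, at distance \<open>norm c\<close>, is an endpoint of the
  first and the last.\<close>

lemma route_length_le:
  assumes "x 0 = 0"
  shows "route_length x p \<le> 2 * norm c + 2 * (\<Sum>i\<leftarrow>p. norm (x i - c))"
proof -
  let ?r = "0 # p @ [0]" and ?h = "\<lambda>i. norm (x i - c)"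
  have "route_length x p \<le> (\<Sum>j\<le>length p. ?h (?r ! j) + ?h (?r ! Suc j))"
    unfolding route_length_def Let_def
    by (intro sum_mono) (metis dist_norm dist_triangle2)
  also have "\<dots> = 2 * norm c + 2 * (\<Sum>i\<leftarrow>p. norm (x i - c))"
    unfolding sum.distrib sum_route_nth[of ?h] using assms by simp
  finally show ?thesis .
qed

lemma norm_telescope_le:
  fixes g :: "nat \<Rightarrow> 'a::real_normed_vector"
  assumes "a \<le> b"
  shows "norm (g a - g b) \<le> (\<Sum>j\<in>{a..<b}. norm (g j - g (Suc j)))"
proof -
  have "(\<Sum>j\<in>{a..<b}. g j - g (Suc j)) = g a - g b"
    using sum_Suc_diff'[OF assms, of "\<lambda>j. - g j"] by simp
  then show ?thesis
    by (metis norm_sum)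
qed

lemma route_length_ge:
  assumes "x 0 = 0" "i \<in> set p"
  shows "2 * norm (x i) \<le> route_length x p"
proof -
  let ?g = "\<lambda>j. x ((0 # p @ [0]) ! j)"
  obtain k where k: "k < length p" "p ! k = i"
    using assms(2) by (auto simp: in_set_conv_nth)
  \<comment> \<open>Position \<open>k\<close> in \<open>p\<close> is position \<open>Suc k\<close>
    in the tour, which begins with the depot. Cutting there leaves a way out to \<open>i\<close> and
    a way back, each of length at least \<open>norm (x i)\<close>.\<close>
  have *: "route_length x p = (\<Sum>j\<in>{0..<Suc k}. norm (?g j - ?g (Suc j)))
      + (\<Sum>j\<in>{Suc k..<Suc (length p)}. norm (?g j - ?g (Suc j)))"
    unfolding route_length_def Let_def using k(1)
    by (subst sum.atLeastLessThan_concat; (simp only: atLeast0LessThan lessThan_Suc_atMost)?)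
  show ?thesis
    using norm_telescope_le[of 0 "Suc k" ?g] norm_telescope_le[of "Suc k" "Suc (length p)" ?g] k assms(1)
    unfolding * by (simp add: nth_append del: sum.op_ivl_Suc)
qed

lemma sum_norm_le_route_length:
  assumes "x 0 = 0" "distinct p" "length p \<le> \<kappa>" "p \<noteq> []"
  shows "(\<Sum>i\<in>set p. 2 * norm (x i)) \<le> real \<kappa> * route_length x p"
proof -
  have "(\<Sum>i\<in>set p. 2 * norm (x i)) \<le> real (card (set p)) * route_length x p"
    by (intro sum_bounded_above route_length_ge assms)
  also have "\<dots> \<le> real \<kappa> * route_length x p"
    using assms by (intro mult_right_mono) (auto simp: distinct_card route_length_def intro!: sum_nonneg)
  finally show ?thesis .
qed

text \<open>Greedy grouping for an abstract cost: full groups are charged to their members through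
  \<open>g\<close>, and each cell leaves at most one incomplete group, charged \<open>C\<close>. The
  induction removes one path at a time; \<open>C\<close> times the number of occupied cells serves
  as a potential.\<close>

lemma group_into_paths:
  fixes cost :: "nat list \<Rightarrow> real" and g :: "nat \<Rightarrow> real" and cell :: "nat \<Rightarrow> 'c"
  assumes "finite A" "\<kappa> \<ge> 1" and "C \<ge> 0" and g: "\<And>i. i \<in> A \<Longrightarrow> g i \<ge> 0"
    and full: "\<And>p k. set p \<subseteq> {i\<in>A. cell i = k} \<Longrightarrow> distinct p \<Longrightarrow> length p = \<kappa> \<Longrightarrow> cost p \<le> sum g (set p)"
    and part: "\<And>p k. set p \<subseteq> {i\<in>A. cell i = k} \<Longrightarrow> distinct p \<Longrightarrow> length p \<le> \<kappa> \<Longrightarrow> p \<noteq> [] \<Longrightarrow> cost p \<le> C"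
  shows "\<exists>P. finite P \<and> (\<forall>p\<in>P. p \<noteq> [] \<and> distinct p \<and> length p \<le> \<kappa>) \<and>
         disjoint_family_on set P \<and> (\<Union>p\<in>P. set p) = A \<and>
         sum cost P \<le> sum g A + C * real (card (cell ` A))"
  using assms(1) g full part
proof (induction A rule: finite_psubset_induct)
  case (psubset A)
  show ?case
  proof (cases "A = {}")
    case True
    then show ?thesis by (intro exI[of _ "{}"]) (auto simp: disjoint_family_on_def)
  next
    case False
    then obtain a where a: "a \<in> A" by blast
    define B where "B = {i\<in>A. cell i = cell a}"
    have finB: "finite B" and aB: "a \<in> B" using psubset.hyps a by (auto simp: B_def)
    \<comment> \<open>Remove either a full group from the cell of \<open>a\<close>, paid for by \<open>g\<close>, or the whole cell, paid for by
      the decrease of the number of occupied cells.\<close>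
    have "\<exists>p. set p \<subseteq> B \<and> distinct p \<and> p \<noteq> [] \<and> length p \<le> \<kappa> \<and>
        cost p + C * real (card (cell ` (A - set p))) \<le> sum g (set p) + C * real (card (cell ` A))"
    proof (cases "\<kappa> \<le> card B")
      case True
      then obtain S where S: "S \<subseteq> B" "card S = \<kappa>" "finite S"
        by (meson obtain_subset_with_card_n)
      obtain p where p: "set p = S" "distinct p" using finite_distinct_list[OF S(3)] by blast
      then have len: "length p = \<kappa>" using S distinct_card by fastforce
      have "cost p \<le> sum g (set p)"
        using psubset.prems(2)[of p "cell a"] p S len by (auto simp: B_def)
      moreover have "card (cell ` (A - set p)) \<le> card (cell ` A)"
        using psubset.hyps by (intro card_mono) auto
      ultimately show ?thesis
        using p S len \<open>\<kappa> \<ge> 1\<close> \<open>C \<ge> 0\<close>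
        by (intro exI[of _ p]) (auto intro!: add_mono mult_left_mono)
    next
      case False
      obtain p where p: "set p = B" "distinct p" using finite_distinct_list[OF finB] by blast
      then have len: "length p \<le> \<kappa>" using False distinct_card by fastforce
      have ne: "p \<noteq> []" using p aB by auto
      have "cost p \<le> C"
        using psubset.prems(3)[of p "cell a"] p len ne by (auto simp: B_def)
      moreover have "cell ` A = insert (cell a) (cell ` (A - B))" "cell a \<notin> cell ` (A - B)"
        using a by (auto simp: B_def)
      then have "card (cell ` A) = Suc (card (cell ` (A - B)))"
        using psubset.hyps by simp
      moreover have "sum g (set p) \<ge> 0"
        using psubset.prems(1) p by (intro sum_nonneg) (auto simp: B_def)
      ultimately show ?thesis
        using p len ne by (intro exI[of _ p]) (auto simp: algebra_simps)
    qed
    then obtain p where p: "set p \<subseteq> B" "distinct p" "p \<noteq> []" "length p \<le> \<kappa>"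
      and cost: "cost p + C * real (card (cell ` (A - set p))) \<le> sum g (set p) + C * real (card (cell ` A))"
      by blast
    have pA: "set p \<subseteq> A" using p by (auto simp: B_def)
    have "A - set p \<subset> A" using pA p by (cases p) auto
    then have "\<exists>P. finite P \<and> (\<forall>p\<in>P. p \<noteq> [] \<and> distinct p \<and> length p \<le> \<kappa>) \<and>
        disjoint_family_on set P \<and> (\<Union>p\<in>P. set p) = A - set p \<and>
        sum cost P \<le> sum g (A - set p) + C * real (card (cell ` (A - set p)))"
    proof (rule psubset.IH)
      show "g i \<ge> 0" if "i \<in> A - set p" for i
        using that psubset.prems(1) by blast
      show "cost q \<le> sum g (set q)"
        if "set q \<subseteq> {i \<in> A - set p. cell i = k}" "distinct q" "length q = \<kappa>" for q k
        using that by (intro psubset.prems(2)[of q k]) auto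
      show "cost q \<le> C"
        if "set q \<subseteq> {i \<in> A - set p. cell i = k}" "distinct q" "length q \<le> \<kappa>" "q \<noteq> []" for q k
        using that by (intro psubset.prems(3)[of q k]) auto
    qed
    then obtain P where P: "finite P" "\<forall>p\<in>P. p \<noteq> [] \<and> distinct p \<and> length p \<le> \<kappa>"
        "disjoint_family_on set P" "(\<Union>p\<in>P. set p) = A - set p"
        "sum cost P \<le> sum g (A - set p) + C * real (card (cell ` (A - set p)))"
      by blast
    \<comment> \<open>A plan is a set of paths, so \<open>p\<close> has to be new for its cost to be
      added to the sum.\<close>
    have notin: "p \<notin> P"
    proof
      assume "p \<in> P"
      then have "set p \<subseteq> A - set p" using P(4) by blast
      then show False using p(3) by (cases p) auto
    qed
    have "sum g A = sum g (set p) + sum g (A - set p)"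
      using sum.subset_diff[OF pA psubset.hyps(1), of g] by simp
    moreover have "disjoint_family_on set (insert p P)"
      using P(3,4) notin by (auto simp: disjoint_family_on_insert)
    ultimately have "sum cost (insert p P) \<le> sum g A + C * real (card (cell ` A))"
      using P(1,5) cost notin by simp
    moreover have "(\<Union>q\<in>insert p P. set q) = A"
      using P(4) pA by auto
    ultimately show ?thesis
      using P(1,2) p \<open>disjoint_family_on set (insert p P)\<close>
      by (intro exI[of _ "insert p P"]) simp
  qed
qed



subsection \<open>Recourse costs\<close>

lemma preventive_cost_nonneg: "0 \<le> preventive_cost x i j"
  unfolding preventive_cost_def using norm_triangle_ineq4[of "x i" "x j"] by simp

lemma failure_cost_nonneg: "0 \<le> failure_cost x i"
  by (simp add: failure_cost_def)

lemma num_failures_nonneg: "0 \<le> num_failures Q s q"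
  by (simp add: num_failures_def)

text \<open>\<open>\<psi>\<close> is the least number of refills that covers the demand, so the load
  left afterwards stays between 0 and \<open>Q\<close>. This keeps inductions over the cost-to-go
  within the range of admissible loads.\<close>

lemma num_failures_load_bounds:
  fixes Q s q :: real
  assumes "Q > 0" "0 \<le> q" "q \<le> Q" "0 \<le> s"
  defines "\<psi> \<equiv> real_of_int (num_failures Q s q)"
  shows "0 \<le> \<psi> * Q + q - s" "\<psi> * Q + q - s \<le> Q"
proof -
  have "0 \<le> \<psi> * Q + q - s \<and> \<psi> * Q + q - s \<le> Q"
  proof (cases "s \<le> q")
    case True
    then have "(s - q) / Q \<le> 0" using assms(1) by (simp add: divide_nonpos_pos)
    then have "\<psi> = 0" by (simp add: \<psi>_def num_failures_def max_def ceiling_le_zero antisym)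
    then show ?thesis using True assms by simp
  next
    case False
    then have "(s - q) / Q > 0" using assms(1) by simp
    then have *: "\<psi> = of_int \<lceil>(s - q) / Q\<rceil>" by (simp add: \<psi>_def num_failures_def max_def)
    have "(s - q) / Q \<le> \<psi>" "\<psi> < (s - q) / Q + 1"
      unfolding * by linarith+
    then show ?thesis using assms(1) by (simp add: field_simps)
  qed
  then show "0 \<le> \<psi> * Q + q - s" "\<psi> * Q + q - s \<le> Q" by auto
qed

lemma serve_cost_nonneg:
  assumes "\<And>q. 0 \<le> F q"
  shows "0 \<le> serve_cost M \<xi> Q x i F q"
  unfolding serve_cost_def Let_def using assms
  by (intro Bochner_Integration.integral_nonneg add_nonneg_nonneg mult_nonneg_nonneg failure_cost_nonneg)
    (simp_all add: num_failures_nonneg)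

lemma cost_to_go_nonneg: "0 \<le> cost_to_go M \<xi> Q x i js q"
  by (induction js arbitrary: i q) (auto simp: serve_cost_nonneg preventive_cost_nonneg add_nonneg_nonneg)

text \<open>The sum counts positive multiples of \<open>Q\<close> below \<open>s\<close>, of which
  there are at most the floor of \<open>s / Q\<close>. The bound does not depend on the truncation
  \<open>L\<close>, so it controls the series over failures.\<close>

lemma multiples_below_le:
  fixes Q s :: real
  assumes "Q > 0" "s \<ge> 0"
  shows "(\<Sum>l<L. indicator {real (Suc l) * Q<..} s) \<le> s / Q"
proof -
  have "(\<Sum>l<L. indicator {real (Suc l) * Q<..} s) = real (card {l. l < L \<and> real (Suc l) * Q < s})"
    by (simp add: indicator_def sum.If_cases Int_def)
  also have "{l. l < L \<and> real (Suc l) * Q < s} \<subseteq> {..<nat \<lfloor>s / Q\<rfloor>}"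
  proof
    fix l assume "l \<in> {l. l < L \<and> real (Suc l) * Q < s}"
    then have "real (Suc l) \<le> s / Q" using assms(1) by (simp add: field_simps)
    then show "l \<in> {..<nat \<lfloor>s / Q\<rfloor>}" by (simp add: le_nat_floor Suc_le_lessD)
  qed
  then have "real (card {l. l < L \<and> real (Suc l) * Q < s}) \<le> real (nat \<lfloor>s / Q\<rfloor>)"
    using card_mono[of "{..<nat \<lfloor>s / Q\<rfloor>}"] by fastforce
  also have "\<dots> \<le> s / Q"
    using assms by (simp add: of_nat_floor)
  finally show ?thesis .
qed

context prob_space
begin

text \<open>
  Without preventive returns, the number of failures times \<open>Q\<close> is the remaining demand minus the
  residual load plus the final residual load, and the latter is at most \<open>Q\<close>.
\<close>

lemma cost_to_go_le:
  assumes "Q > 0" "B \<ge> 0"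
    and B: "\<And>j. j \<in> set js \<Longrightarrow> failure_cost x j \<le> B"
    and nn: "\<And>j \<omega>. j \<in> set js \<Longrightarrow> \<omega> \<in> space M \<Longrightarrow> 0 \<le> \<xi> j \<omega>"
    and int: "\<And>j. j \<in> set js \<Longrightarrow> integrable M (\<xi> j)"
    and q: "0 \<le> q" "q \<le> Q"
  shows "cost_to_go M \<xi> Q x i js q \<le> B * ((\<Sum>j\<leftarrow>js. expectation (\<xi> j)) + Q - q) / Q"
  using B nn int q
proof (induction js arbitrary: i q)
  case Nil
  then show ?case using assms by simp
next
  case (Cons j js)
  let ?F = "cost_to_go M \<xi> Q x j js" and ?m = "\<Sum>j\<leftarrow>js. expectation (\<xi> j)"
  let ?\<psi> = "\<lambda>\<omega>. real_of_int (num_failures Q (\<xi> j \<omega>) q)"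
  let ?f = "\<lambda>\<omega>. B * (?m + Q + \<xi> j \<omega> - q) / Q"
  have m: "?m \<ge> 0"
    using Cons.prems(2) by (intro sum_list_nonneg) (auto intro!: Bochner_Integration.integral_nonneg)
  have [simp]: "integrable M (\<xi> j)" using Cons.prems(3) by simp
  have pointwise: "failure_cost x j * ?\<psi> \<omega> + ?F (?\<psi> \<omega> * Q + q - \<xi> j \<omega>) \<le> ?f \<omega>"
    if "\<omega> \<in> space M" for \<omega>
  proof -
    have nnj: "0 \<le> \<xi> j \<omega>" using Cons.prems(2) that by simp
    have "?F (?\<psi> \<omega> * Q + q - \<xi> j \<omega>) \<le> B * (?m + Q - (?\<psi> \<omega> * Q + q - \<xi> j \<omega>)) / Q"
      using Cons.prems nnj num_failures_load_bounds[OF \<open>Q > 0\<close> Cons.prems(4,5) nnj]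
      by (intro Cons.IH) auto
    moreover have "failure_cost x j * ?\<psi> \<omega> \<le> B * ?\<psi> \<omega>"
      using Cons.prems(1) by (intro mult_right_mono) (auto simp: num_failures_nonneg)
    \<comment> \<open>The refills cancel: each failure costs at most \<open>B\<close> and raises the
      residual load by \<open>Q\<close>. What remains is affine in the demand, so only its mean
      enters after integration.\<close>
    moreover have "B * ?\<psi> \<omega> + B * (?m + Q - (?\<psi> \<omega> * Q + q - \<xi> j \<omega>)) / Q = ?f \<omega>"
      using \<open>Q > 0\<close> by (simp add: field_simps)
    ultimately show ?thesis by linarith
  qed
  have "cost_to_go M \<xi> Q x i (j # js) q \<le> serve_cost M \<xi> Q x j ?F q"
    by simp
  also have "\<dots> \<le> (\<integral>\<omega>. ?f \<omega> \<partial>M)"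
    unfolding serve_cost_def Let_def
    \<comment> \<open>If the integrand on the left is not integrable, its integral is 0; so no measurability of the
      cost-to-go is needed.\<close>
  proof (rule integral_mono')
    show "integrable M ?f"
      by (intro integrable_divide integrable_mult_right Bochner_Integration.integrable_diff
          Bochner_Integration.integrable_add) auto
    \<comment> \<open>Here \<open>q \<le> Q\<close> ensures the sign.\<close>
    show "0 \<le> ?f \<omega>" if "\<omega> \<in> space M" for \<omega>
      using m Cons.prems that assms(1,2)
      by (intro divide_nonneg_pos mult_nonneg_nonneg) (auto simp: add_increasing2 add_nonneg_nonneg)
  qed (rule pointwise)
  also have "\<dots> = B * ((\<Sum>j\<leftarrow>j # js. expectation (\<xi> j)) + Q - q) / Q"
    by (simp add: prob_space algebra_simps)
  finally show ?case .
qed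

text \<open>Integrating the pointwise count of multiples of \<open>Q\<close> below \<open>S\<close>
  turns it into a sum of tail probabilities.\<close>

lemma sum_prob_exceeds_le:
  fixes S :: "'a \<Rightarrow> real"
  assumes "Q > 0" and nn: "\<And>\<omega>. \<omega> \<in> space M \<Longrightarrow> 0 \<le> S \<omega>" and int: "integrable M S"
  shows "(\<Sum>l<L. prob {\<omega>\<in>space M. real (Suc l) * Q < S \<omega>}) \<le> expectation S / Q"
proof -
  have [measurable]: "S \<in> borel_measurable M" using int by simp
  have "(\<Sum>l<L. prob {\<omega>\<in>space M. real (Suc l) * Q < S \<omega>})
      = (\<Sum>l<L. expectation (\<lambda>\<omega>. indicator {\<omega>\<in>space M. real (Suc l) * Q < S \<omega>} \<omega>))"
    by (rule sum.cong) (auto simp: Int_def intro!: arg_cong[where f = prob])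
  also have "\<dots> = expectation (\<lambda>\<omega>. \<Sum>l<L. indicator {\<omega>\<in>space M. real (Suc l) * Q < S \<omega>} \<omega>)"
    by (intro Bochner_Integration.integral_sum[symmetric]) (simp add: less_top[symmetric])
  also have "\<dots> \<le> expectation (\<lambda>\<omega>. S \<omega> / Q)"
  proof (rule integral_mono')
    fix \<omega> assume w: "\<omega> \<in> space M"
    then have "(\<Sum>l<L. indicator {\<omega>\<in>space M. real (Suc l) * Q < S \<omega>} \<omega>)
        = (\<Sum>l<L. indicat_real {real (Suc l) * Q<..} (S \<omega>))"
      by (intro sum.cong) (auto simp: indicator_def)
    then show "(\<Sum>l<L. indicator {\<omega>\<in>space M. real (Suc l) * Q < S \<omega>} \<omega>) \<le> S \<omega> / Q"
      using multiples_below_le[OF \<open>Q > 0\<close> nn[OF w], of L] by simp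
  qed (use assms in auto)
  finally show ?thesis by simp
qed

text \<open>With \<open>f\<close> and \<open>g\<close> the demand before and after a customer, this
  writes the probability of a failure there as a difference of tails, which telescopes along the
  path.\<close>

lemma prob_between_eq_diff:
  fixes f g :: "'a \<Rightarrow> real"
  assumes [measurable]: "f \<in> borel_measurable M" "g \<in> borel_measurable M"
    and le: "\<And>\<omega>. \<omega> \<in> space M \<Longrightarrow> f \<omega> \<le> g \<omega>"
  shows "prob {\<omega>\<in>space M. f \<omega> \<le> z \<and> z < g \<omega>} = prob {\<omega>\<in>space M. z < g \<omega>} - prob {\<omega>\<in>space M. z < f \<omega>}"
proof -
  have "{\<omega>\<in>space M. f \<omega> \<le> z \<and> z < g \<omega>} = {\<omega>\<in>space M. z < g \<omega>} - {\<omega>\<in>space M. z < f \<omega>}"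
    by auto
  moreover have "prob ({\<omega>\<in>space M. z < g \<omega>} - {\<omega>\<in>space M. z < f \<omega>})
      = prob {\<omega>\<in>space M. z < g \<omega>} - prob {\<omega>\<in>space M. z < f \<omega>}"
    by (rule finite_measure_Diff) (use le in force)+
  ultimately show ?thesis by simp
qed

text \<open>For fixed \<open>l\<close> the failure probabilities along the path add up to the
  probability that the total demand exceeds the multiple of \<open>Q\<close>. Summed over
  \<open>l\<close>, this bounds the expected number of failures by the mean total demand over
  \<open>Q\<close>, and each failure costs at most \<open>B\<close>.\<close>

lemma dtd_cost_bounds:
  assumes "Q > 0"
    and B: "\<And>j. j \<in> set p \<Longrightarrow> failure_cost x j \<le> B"
    and nn: "\<And>j \<omega>. j \<in> set p \<Longrightarrow> \<omega> \<in> space M \<Longrightarrow> 0 \<le> \<xi> j \<omega>"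
    and int: "\<And>j. j \<in> set p \<Longrightarrow> integrable M (\<xi> j)" and "B \<ge> 0"
  shows "0 \<le> dtd_cost M \<xi> Q x p" (is ?nonneg)
    and "dtd_cost M \<xi> Q x p \<le> B * (\<Sum>j\<leftarrow>p. expectation (\<xi> j)) / Q" (is ?upper)
proof -
  let ?S = "\<lambda>n \<omega>. \<Sum>k<n. \<xi> (p ! k) \<omega>"
  \<comment> \<open>\<open>a j l\<close> is the probability that failure number \<open>Suc l\<close>
    occurs at position \<open>j\<close>, and \<open>b l\<close> below the probability that at least
    \<open>Suc l\<close> failures occur on the path.\<close>
  define a where "a j l = prob {\<omega> \<in> space M. ?S j \<omega> \<le> real (Suc l) * Q \<and> real (Suc l) * Q < ?S (Suc j) \<omega>}" for j l
  define b where "b l = prob {\<omega>\<in>space M. real (Suc l) * Q < ?S (length p) \<omega>}" for l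
  have dtd: "dtd_cost M \<xi> Q x p = (\<Sum>j<length p. \<Sum>l. a j l * failure_cost x (p ! j))"
    by (simp add: dtd_cost_def a_def lessThan_Suc_atMost)
  have intS: "integrable M (?S n)" if "n \<le> length p" for n
    using that by (intro Bochner_Integration.integrable_sum int) auto
  have S_nn: "0 \<le> ?S n \<omega>" if "n \<le> length p" "\<omega> \<in> space M" for n \<omega>
    using that by (intro sum_nonneg nn) auto
  have a_nn: "0 \<le> a j l" for j l by (simp add: a_def)
  have tele: "(\<Sum>j<n. a j l) = prob {\<omega>\<in>space M. real (Suc l) * Q < ?S n \<omega>}" if "n \<le> length p" for n l
    using that
  proof (induction n)
    case 0
    have "\<not> real (Suc l) * Q < 0" using \<open>Q > 0\<close> by (simp add: not_less)
    then show ?case by simp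
  next
    case (Suc n)
    have "?S n \<omega> \<le> ?S (Suc n) \<omega>" if "\<omega> \<in> space M" for \<omega>
      using nn[of "p ! n"] that Suc.prems by simp
    then have "a n l = prob {\<omega>\<in>space M. real (Suc l) * Q < ?S (Suc n) \<omega>}
        - prob {\<omega>\<in>space M. real (Suc l) * Q < ?S n \<omega>}"
      unfolding a_def using Suc.prems
      by (intro prob_between_eq_diff borel_measurable_integrable intS) auto
    then show ?case using Suc by simp
  qed
  \<comment> \<open>Exchanging the sums over positions and over \<open>l\<close> leaves only the total demand \<open>?S (length p)\<close>.\<close>
  have b_sum: "(\<Sum>j<length p. a j l) = b l" for l
    by (simp add: tele b_def)
  have b_le: "(\<Sum>l<L. b l) \<le> expectation (?S (length p)) / Q" for L
    unfolding b_def by (intro sum_prob_exceeds_le \<open>Q > 0\<close> S_nn intS) auto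
  have "summable b"
    by (rule summableI_nonneg_bounded[OF _ b_le]) (simp add: b_def)
  \<comment> \<open>\<open>a j l\<close> is one of the nonnegative terms whose sum is
    \<open>b l\<close>. Summability is what permits interchanging the sums and pulling out the
    failure cost.\<close>
  have a_sum: "summable (a j)" if "j < length p" for j
  proof (rule summable_comparison_test'[OF \<open>summable b\<close>])
    show "norm (a j l) \<le> b l" for l
      using member_le_sum[of j "{..<length p}" "\<lambda>j. a j l"] that a_nn by (simp flip: b_sum)
  qed
  have dtd': "dtd_cost M \<xi> Q x p = (\<Sum>j<length p. suminf (a j) * failure_cost x (p ! j))"
    unfolding dtd by (intro sum.cong refl suminf_mult2[symmetric] a_sum) auto
  have sa_nn: "0 \<le> suminf (a j)" if "j < length p" for j
    using a_nn a_sum[OF that] by (intro suminf_nonneg)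
  show ?nonneg
    unfolding dtd' using sa_nn by (intro sum_nonneg mult_nonneg_nonneg failure_cost_nonneg) auto
  have "dtd_cost M \<xi> Q x p \<le> (\<Sum>j<length p. suminf (a j) * B)"
    unfolding dtd' using sa_nn by (intro sum_mono mult_left_mono B) auto
  also have "\<dots> = suminf b * B"
    using suminf_sum[of "{..<length p}" a] a_sum by (simp add: b_sum flip: sum_distrib_right)
  also have "\<dots> \<le> expectation (?S (length p)) / Q * B"
    using \<open>B \<ge> 0\<close> by (intro mult_right_mono suminf_le_const \<open>summable b\<close> b_le)
  also have "expectation (?S (length p)) = (\<Sum>k<length p. expectation (\<xi> (p ! k)))"
    by (intro Bochner_Integration.integral_sum int) auto
  also have "\<dots> = (\<Sum>j\<leftarrow>p. expectation (\<xi> j))"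
    by (simp add: sum_list_sum_nth atLeast0LessThan)
  finally show ?upper by (simp add: mult_ac)
qed

lemma recourse_cost_bounds:
  assumes "Q > 0"
    and B: "\<And>j. j \<in> set p \<Longrightarrow> failure_cost x j \<le> B"
    and nn: "\<And>j \<omega>. j \<in> set p \<Longrightarrow> \<omega> \<in> space M \<Longrightarrow> 0 \<le> \<xi> j \<omega>"
    and int: "\<And>j. j \<in> set p \<Longrightarrow> integrable M (\<xi> j)"
    and mean: "\<And>j. j \<in> set p \<Longrightarrow> expectation (\<xi> j) = \<mu>" and "B \<ge> 0"
  shows "0 \<le> recourse_cost \<pi> M \<xi> Q x p"
    and "recourse_cost \<pi> M \<xi> Q x p \<le> B * (real (length p) * \<mu>) / Q"
proof -
  have len: "(\<Sum>j\<leftarrow>p. expectation (\<xi> j)) = real (length p) * \<mu>"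
    using mean by (simp add: sum_list_triv cong: map_cong)
  \<comment> \<open>Under restocking the vehicle starts with \<open>q = Q\<close>, so the term
    \<open>Q - q\<close> of the general bound vanishes and both policies obey the same
    estimate.\<close>
  have dir: "0 \<le> directed_recourse_cost \<pi> M \<xi> Q x q"
      "directed_recourse_cost \<pi> M \<xi> Q x q \<le> B * (\<Sum>j\<leftarrow>q. expectation (\<xi> j)) / Q"
    if "set q = set p" for q
    using dtd_cost_bounds[of Q q x B \<xi>] cost_to_go_le[of Q B q x \<xi> Q 0] assms that
    by (cases \<pi>; simp add: or_cost_def cost_to_go_nonneg)+
  show "0 \<le> recourse_cost \<pi> M \<xi> Q x p"
    unfolding recourse_cost_def using dir(1)[of p] dir(1)[of "rev p"] by simp
  show "recourse_cost \<pi> M \<xi> Q x p \<le> B * (real (length p) * \<mu>) / Q"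
    unfolding recourse_cost_def using dir(2)[of p] by (simp add: len min.coboundedI1)
qed

end


subsection \<open>Optimal plans\<close>

lemma finite_ecc_plan:
  assumes "P \<in> ecc_plans \<kappa> n"
  shows "finite P"
proof (rule finite_subset)
  show "P \<subseteq> {p. set p \<subseteq> {1..n} \<and> length p \<le> \<kappa>}"
    using assms by (auto simp: ecc_plans_def)
  show "finite {p. set p \<subseteq> {1..n} \<and> length p \<le> \<kappa>}"
    by (rule finite_lists_length_le) simp
qed

section \<open>Transfer between identically distributed variables\<close>

lemma distr_compose_eq:
  assumes "distr M borel f = distr M borel g" "f \<in> borel_measurable M" "g \<in> borel_measurable M"
    and "h \<in> borel_measurable borel"
  shows "distr M borel (\<lambda>\<omega>. h (f \<omega>)) = distr M borel (\<lambda>\<omega>. h (g \<omega>))"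
  using distr_distr[OF assms(4,2)] distr_distr[OF assms(4,3)] assms(1) by (simp add: comp_def)

lemma same_distr_real:
  fixes f g :: "'a \<Rightarrow> real"
  assumes "distr M borel f = distr M borel g" "f \<in> borel_measurable M" "g \<in> borel_measurable M"
  shows "integrable M f \<longleftrightarrow> integrable M g" and "(\<integral>\<omega>. f \<omega> \<partial>M) = (\<integral>\<omega>. g \<omega> \<partial>M)"
  using integrable_distr_eq[of f M borel "\<lambda>x. x"] integrable_distr_eq[of g M borel "\<lambda>x. x"]
    integral_distr[of f M borel "\<lambda>x. x"] integral_distr[of g M borel "\<lambda>x. x"] assms by auto

section \<open>Bounds on the optimal cost for a fixed sequence of locations\<close>

context prob_space
begin

context
  fixes x :: "nat \<Rightarrow> point" and \<xi> :: "nat \<Rightarrow> 'a \<Rightarrow> real" and Q \<mu> :: real and \<kappa> :: nat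
  assumes Q: "Q > 0" and \<kappa>: "\<kappa> \<ge> 1" and depot: "x 0 = 0"
    and demand_nn: "\<And>i \<omega>. i \<ge> 1 \<Longrightarrow> \<omega> \<in> space M \<Longrightarrow> 0 \<le> \<xi> i \<omega>"
    and demand_int: "\<And>i. i \<ge> 1 \<Longrightarrow> integrable M (\<xi> i)"
    and demand_mean: "\<And>i. i \<ge> 1 \<Longrightarrow> expectation (\<xi> i) = \<mu>"
begin

lemma path_recourse_bounds:
  assumes "0 \<notin> set p" "B \<ge> 0" "\<And>j. j \<in> set p \<Longrightarrow> failure_cost x j \<le> B"
  shows "0 \<le> recourse_cost \<pi> M \<xi> Q x p"
    and "recourse_cost \<pi> M \<xi> Q x p \<le> B * (real (length p) * \<mu>) / Q"
proof -
  have pos: "j \<ge> 1" if "j \<in> set p" for j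
    using that assms(1) by (cases "j = 0") auto
  show "0 \<le> recourse_cost \<pi> M \<xi> Q x p"
    and "recourse_cost \<pi> M \<xi> Q x p \<le> B * (real (length p) * \<mu>) / Q"
    using recourse_cost_bounds[of Q p x B \<xi> \<mu> \<pi>, OF Q assms(3) demand_nn[OF pos] demand_int[OF pos]
        demand_mean[OF pos] assms(2)] by simp_all
qed

lemma ecc_opt_ge:
  "2 / real \<kappa> * (\<Sum>i\<in>{1..n}. norm (x i)) \<le> ecc_opt \<pi> M \<xi> Q \<kappa> x n"
proof -
  have "2 / real \<kappa> * (\<Sum>i\<in>{1..n}. norm (x i)) \<le> (\<Sum>p\<in>P. route_length x p + recourse_cost \<pi> M \<xi> Q x p)"
    if P: "P \<in> ecc_plans \<kappa> n" for P
  proof -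
    have "{1..n} = (\<Union>p\<in>P. set p)" using P by (auto simp: ecc_plans_def)
    moreover have "(\<Sum>i\<in>(\<Union>p\<in>P. set p). norm (x i)) = (\<Sum>p\<in>P. \<Sum>i\<in>set p. norm (x i))"
      using P finite_ecc_plan[OF P] by (intro sum.UNION_disjoint_family) (auto simp: ecc_plans_def)
    ultimately have "2 / real \<kappa> * (\<Sum>i\<in>{1..n}. norm (x i)) = (\<Sum>p\<in>P. 2 / real \<kappa> * (\<Sum>i\<in>set p. norm (x i)))"
      by (simp add: sum_distrib_left)
    also have "\<dots> \<le> (\<Sum>p\<in>P. route_length x p + recourse_cost \<pi> M \<xi> Q x p)"
    proof (rule sum_mono)
      fix p assume "p \<in> P"
      then have p: "p \<noteq> []" "distinct p" "length p \<le> \<kappa>" "set p \<subseteq> {1..n}"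
        using P by (auto simp: ecc_plans_def)
      have "2 / real \<kappa> * (\<Sum>i\<in>set p. norm (x i)) \<le> route_length x p"
        using sum_norm_le_route_length[of x, OF depot p(2,3,1)] \<kappa>
        by (simp add: field_simps flip: sum_distrib_left)
      \<comment> \<open>For the sign any bound on the failure costs will do; their sum over the path
        is one.\<close>
      moreover have "0 \<le> recourse_cost \<pi> M \<xi> Q x p"
        using p(4) by (intro path_recourse_bounds(1)[of p "\<Sum>j\<in>set p. failure_cost x j"] sum_nonneg
            member_le_sum) (auto simp: failure_cost_nonneg)
      ultimately show "2 / real \<kappa> * (\<Sum>i\<in>set p. norm (x i)) \<le> route_length x p + recourse_cost \<pi> M \<xi> Q x p"
        by simp
    qed
    finally show ?thesis .
  qed
  then show ?thesis
    unfolding ecc_opt_def using \<kappa> by (intro Min.boundedI) (auto simp: finite_ecc_plans ecc_plans_nonempty)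
qed

text \<open>The legs are routed through the centre \<open>c\<close>, and every failure costs at most
  \<open>2 * (norm c + \<epsilon>)\<close>. The bound depends on the path only through its
  length.\<close>

lemma cell_path_cost_le:
  assumes "0 \<notin> set p" "\<mu> \<ge> 0" "\<And>i. i \<in> set p \<Longrightarrow> norm (x i - c) \<le> \<epsilon>" "\<epsilon> > 0"
  shows "route_length x p + recourse_cost \<pi> M \<xi> Q x p
    \<le> 2 * norm c + 2 * real (length p) * \<epsilon> + 2 * (norm c + \<epsilon>) * (real (length p) * \<mu>) / Q"
proof (rule add_mono)
  have "(\<Sum>i\<leftarrow>p. norm (x i - c)) \<le> (\<Sum>i\<leftarrow>p. \<epsilon>)"
    using assms(3) by (rule sum_list_mono)
  then show "route_length x p \<le> 2 * norm c + 2 * real (length p) * \<epsilon>"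
    using route_length_le[of x p c] depot by (simp add: sum_list_triv)
  have "failure_cost x i \<le> 2 * (norm c + \<epsilon>)" if "i \<in> set p" for i
    using assms(3)[OF that] norm_triangle_sub[of "x i" c] by (simp add: failure_cost_def)
  then show "recourse_cost \<pi> M \<xi> Q x p \<le> 2 * (norm c + \<epsilon>) * (real (length p) * \<mu>) / Q"
    using assms by (intro path_recourse_bounds(2)) auto
qed

text \<open>The constant \<open>C\<close> may depend on \<open>\<epsilon>\<close> through the
  covering but not on \<open>n\<close>, so it disappears from the average.\<close>

lemma ecc_opt_le:
  assumes "compact R" "\<And>i. i \<ge> 1 \<Longrightarrow> x i \<in> R" "\<epsilon> > 0" "\<mu> \<ge> 0"
  obtains C where "\<And>n. ecc_opt \<pi> M \<xi> Q \<kappa> x n \<le> (2 / real \<kappa> + 2 * \<mu> / Q) * (\<Sum>i\<in>{1..n}. norm (x i))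
      + (2 / real \<kappa> + 4 * \<mu> / Q + 2) * \<epsilon> * real n + C"
proof -
  let ?cost = "\<lambda>p. route_length x p + recourse_cost \<pi> M \<xi> Q x p"
  \<comment> \<open>The error per customer of a full group is \<open>2 * \<epsilon>\<close> from the
    legs, \<open>2 * \<mu> / Q * \<epsilon>\<close> from the failure costs, and
    \<open>(2 / real \<kappa> + 2 * \<mu> / Q) * \<epsilon>\<close> from replacing
    \<open>norm c\<close> by the average distance of the group.\<close>
  let ?g = "\<lambda>i. (2 / real \<kappa> + 2 * \<mu> / Q) * norm (x i) + (2 / real \<kappa> + 4 * \<mu> / Q + 2) * \<epsilon>"
  obtain K where K: "finite K" "R \<subseteq> (\<Union>c\<in>K. ball c \<epsilon>)"
    using assms(1,3) by (auto simp: compact_eq_totally_bounded)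
  then have "\<exists>c. c \<in> K \<and> norm (x i - c) \<le> \<epsilon>" if "i \<ge> 1" for i
    using assms(2)[OF that] by (fastforce simp: dist_norm norm_minus_commute)
  \<comment> \<open>Choosing one centre per customer makes the cells disjoint although the balls may
    overlap.\<close>
  then obtain cell where cell: "cell i \<in> K" "norm (x i - cell i) \<le> \<epsilon>" if "i \<ge> 1" for i
    by metis
  define D where "D = (\<Sum>c\<in>K. norm c)"
  have D: "norm c \<le> D" if "c \<in> K" for c
    unfolding D_def using that K(1) by (intro member_le_sum) auto
  have "D \<ge> 0" by (simp add: D_def sum_nonneg)
  \<comment> \<open>This is the path bound at its worst: centre norm \<open>D\<close> and
    \<open>\<kappa>\<close> customers.\<close>
  define C where "C = 2 * D + 2 * real \<kappa> * \<epsilon> + 2 * (D + \<epsilon>) * (real \<kappa> * \<mu>) / Q"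
  have "C \<ge> 0" using \<open>D \<ge> 0\<close> assms Q by (simp add: C_def)
  have "ecc_opt \<pi> M \<xi> Q \<kappa> x n \<le> sum ?g {1..n} + C * real (card K)" for n
  proof -
    have cost: "?cost p \<le> 2 * norm c + 2 * real (length p) * \<epsilon> + 2 * (norm c + \<epsilon>) * (real (length p) * \<mu>) / Q"
      if "set p \<subseteq> {i\<in>{1..n}. cell i = c}" for p c
      using that cell(2) assms(3,4) by (intro cell_path_cost_le) fastforce+
    have "\<exists>P. finite P \<and> (\<forall>p\<in>P. p \<noteq> [] \<and> distinct p \<and> length p \<le> \<kappa>) \<and>
         disjoint_family_on set P \<and> (\<Union>p\<in>P. set p) = {1..n} \<and>
         sum ?cost P \<le> sum ?g {1..n} + C * real (card (cell ` {1..n}))"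
    proof (rule group_into_paths[OF _ \<kappa> \<open>C \<ge> 0\<close>])
      show "0 \<le> ?g i" for i
        using Q assms(3,4) by simp
    next
      fix p c assume p: "set p \<subseteq> {i\<in>{1..n}. cell i = c}" "distinct p" "length p = \<kappa>"
      \<comment> \<open>Exactly \<open>\<kappa>\<close> customers share the cost
        \<open>2 * norm c\<close> of reaching the cell, which gives the factor
        \<open>2 / real \<kappa>\<close>. A smaller group cannot spread it as far and is charged to
        \<open>C\<close>.\<close>
      have "real (card (set p)) * norm c \<le> (\<Sum>i\<in>set p. norm (x i) + \<epsilon>)"
      proof (rule sum_bounded_below)
        fix i assume "i \<in> set p"
        then have "norm (x i - c) \<le> \<epsilon>" using p(1) cell(2)[of i] by auto
        then show "norm c \<le> norm (x i) + \<epsilon>"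
          using norm_triangle_sub[of c "x i"] by (simp add: norm_minus_commute)
      qed
      then have *: "real \<kappa> * norm c \<le> (\<Sum>i\<in>set p. norm (x i)) + real \<kappa> * \<epsilon>"
        using p(2,3) by (simp add: distinct_card sum.distrib)
      have "?cost p \<le> 2 * norm c + 2 * real \<kappa> * \<epsilon> + 2 * (norm c + \<epsilon>) * (real \<kappa> * \<mu>) / Q"
        using cost[OF p(1)] p(3) by simp
      also have "\<dots> = (2 / real \<kappa> + 2 * \<mu> / Q) * (real \<kappa> * norm c) + 2 * real \<kappa> * \<epsilon> + 2 * \<epsilon> * (real \<kappa> * \<mu>) / Q"
        using \<kappa> Q by (simp add: field_simps)
      also have "\<dots> \<le> (2 / real \<kappa> + 2 * \<mu> / Q) * ((\<Sum>i\<in>set p. norm (x i)) + real \<kappa> * \<epsilon>)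
          + 2 * real \<kappa> * \<epsilon> + 2 * \<epsilon> * (real \<kappa> * \<mu>) / Q"
        using * \<kappa> Q assms(4) by (intro add_mono mult_left_mono) auto
      also have "\<dots> = (2 / real \<kappa> + 2 * \<mu> / Q) * (\<Sum>i\<in>set p. norm (x i))
          + real \<kappa> * ((2 / real \<kappa> + 4 * \<mu> / Q + 2) * \<epsilon>)"
        using \<kappa> Q by (simp add: field_simps)
      also have "\<dots> = sum ?g (set p)"
        using p(2,3) by (simp add: sum.distrib sum_distrib_left distinct_card)
      finally show "?cost p \<le> sum ?g (set p)" .
    next
      fix p c assume p: "set p \<subseteq> {i\<in>{1..n}. cell i = c}" "length p \<le> \<kappa>" "p \<noteq> []"
      then have "norm c \<le> D"
        using cell(1) D by (cases p) auto
      then have "2 * norm c + 2 * real (length p) * \<epsilon> + 2 * (norm c + \<epsilon>) * (real (length p) * \<mu>) / Q \<le> C"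
        unfolding C_def using p(2) Q assms(3,4) \<open>D \<ge> 0\<close>
        by (intro add_mono mult_mono divide_right_mono) auto
      with cost[OF p(1)] show "?cost p \<le> C" by simp
    qed auto
    then obtain P where P: "P \<in> ecc_plans \<kappa> n"
      "sum ?cost P \<le> sum ?g {1..n} + C * real (card (cell ` {1..n}))"
      by (auto simp: ecc_plans_def)
    have "ecc_opt \<pi> M \<xi> Q \<kappa> x n \<le> sum ?cost P"
      unfolding ecc_opt_def using P(1) by (intro Min_le) (auto simp: finite_ecc_plans)
    moreover have "card (cell ` {1..n}) \<le> card K"
      using cell(1) K(1) by (intro card_mono) auto
    then have "C * real (card (cell ` {1..n})) \<le> C * real (card K)"
      using \<open>C \<ge> 0\<close> by (intro mult_left_mono) auto
    ultimately show ?thesis using P(2) by linarith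
  qed
  moreover have "sum ?g {1..n} = (2 / real \<kappa> + 2 * \<mu> / Q) * (\<Sum>i\<in>{1..n}. norm (x i))
      + (2 / real \<kappa> + 4 * \<mu> / Q + 2) * \<epsilon> * real n" for n
    by (simp only: sum.distrib sum_distrib_left[symmetric] sum_constant) simp
  ultimately show ?thesis
    by (intro that[of "C * real (card K)"]) simp
qed

lemma ecc_opt_liminf_limsup:
  assumes R: "compact R" "\<And>i. i \<ge> 1 \<Longrightarrow> x i \<in> R" and \<mu>: "\<mu> \<ge> 0"
    and avg: "(\<lambda>n. (\<Sum>i\<in>{1..n}. norm (x i)) / real n) \<longlonglongrightarrow> d"
  shows "ereal (2 / real \<kappa> * d) \<le> liminf (\<lambda>n. ereal (ecc_opt \<pi> M \<xi> Q \<kappa> x n / real n))"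
    and "limsup (\<lambda>n. ereal (ecc_opt \<pi> M \<xi> Q \<kappa> x n / real n)) \<le> ereal ((2 / real \<kappa> + 2 * \<mu> / Q) * d)"
proof -
  let ?S = "\<lambda>n. \<Sum>i\<in>{1..n}. norm (x i)" and ?V = "\<lambda>n. ecc_opt \<pi> M \<xi> Q \<kappa> x n"
  let ?a = "2 / real \<kappa> + 2 * \<mu> / Q" and ?k = "2 / real \<kappa> + 4 * \<mu> / Q + 2"
  have "(\<lambda>n. ereal (2 / real \<kappa> * (?S n / real n))) \<longlonglongrightarrow> ereal (2 / real \<kappa> * d)"
    by (intro tendsto_ereal tendsto_mult_left avg)
  then have "ereal (2 / real \<kappa> * d) = liminf (\<lambda>n. ereal (2 / real \<kappa> * (?S n / real n)))"
    by (intro lim_imp_Liminf[symmetric]) auto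
  also have "\<dots> \<le> liminf (\<lambda>n. ereal (?V n / real n))"
    using divide_right_mono[OF ecc_opt_ge] by (intro Liminf_mono always_eventually) auto
  finally show "ereal (2 / real \<kappa> * d) \<le> liminf (\<lambda>n. ereal (?V n / real n))" .
  have k: "?k > 0" using Q \<mu> by (intro add_nonneg_pos) auto
  show "limsup (\<lambda>n. ereal (?V n / real n)) \<le> ereal (?a * d)"
  proof (rule ereal_le_epsilon2)
    fix e :: real assume "e > 0"
    \<comment> \<open>The radius \<open>e / ?k\<close> makes the error per customer exactly
      \<open>e\<close>.\<close>
    then have "e / ?k > 0" using k by simp
    from ecc_opt_le[OF R this \<mu>, of \<pi>] obtain C where C: "?V n \<le> ?a * ?S n + ?k * (e / ?k) * real n + C" for n
      by blast
    have "(\<lambda>n. ?a * (?S n / real n) + e + C / real n) \<longlonglongrightarrow> ?a * d + e + 0"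
      by (intro tendsto_add tendsto_mult_left avg tendsto_const lim_const_over_n)
    then have "(\<lambda>n. ereal (?a * (?S n / real n) + e + C / real n)) \<longlonglongrightarrow> ereal (?a * d + e)"
      by (intro tendsto_ereal) simp
    then have lim: "limsup (\<lambda>n. ereal (?a * (?S n / real n) + e + C / real n)) = ereal (?a * d + e)"
      by (intro lim_imp_Limsup) auto
    have "?V n / real n \<le> ?a * (?S n / real n) + e + C / real n" if "n \<ge> 1" for n
    proof -
      have "?V n / real n \<le> (?a * ?S n + e * real n + C) / real n"
        using C[of n] k by (intro divide_right_mono) auto
      also have "\<dots> = ?a * (?S n / real n) + e + C / real n"
        using that by (simp add: add_divide_distrib)
      finally show ?thesis .
    qed
    then have "limsup (\<lambda>n. ereal (?V n / real n)) \<le> limsup (\<lambda>n. ereal (?a * (?S n / real n) + e + C / real n))"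
      by (intro Limsup_mono eventually_sequentiallyI[of 1]) simp
    then show "limsup (\<lambda>n. ereal (?V n / real n)) \<le> ereal (?a * d) + ereal e"
      unfolding lim by simp
  qed
qed

end

end

section \<open>Almost sure bounds for random locations\<close>

theorem theorem12:
  fixes M :: "'w measure" and R :: "(real ^ 2) set"
    and X :: "nat \<Rightarrow> 'w \<Rightarrow> real ^ 2" and \<xi> :: "nat \<Rightarrow> 'w \<Rightarrow> real"
    and Q \<mu> d \<alpha> :: real and \<kappa> :: nat and \<pi> :: policy
  assumes "prob_space M"
    and "compact R"
    and "\<And>i \<omega>. i \<ge> 1 \<Longrightarrow> \<omega> \<in> space M \<Longrightarrow> X i \<omega> \<in> R \<and> 0 \<le> \<xi> i \<omega>"
    and "\<And>\<omega>. \<omega> \<in> space M \<Longrightarrow> X 0 \<omega> = 0"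
    and "prob_space.indep_vars M (\<lambda>_. borel) (\<lambda>i \<omega>. (X i \<omega>, \<xi> i \<omega>)) {1..}"
    and "\<And>i. i \<ge> 1 \<Longrightarrow>
           distr M borel (\<lambda>\<omega>. (X i \<omega>, \<xi> i \<omega>)) = distr M borel (\<lambda>\<omega>. (X 1 \<omega>, \<xi> 1 \<omega>))"
    and "\<And>i. i \<ge> 1 \<Longrightarrow> prob_space.indep_set M
           {X i -` A \<inter> space M |A. A \<in> sets borel} {\<xi> i -` B \<inter> space M |B. B \<in> sets borel}"
    and "integrable M (\<xi> 1)" and "\<mu> = (\<integral>\<omega>. \<xi> 1 \<omega> \<partial>M)" and "\<mu> > 0"
    and "integrable M (\<lambda>\<omega>. norm (X 1 \<omega>))" and "d = (\<integral>\<omega>. norm (X 1 \<omega>) \<partial>M)" and "d > 0"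
    and "Q > 0" and "\<mu> \<le> Q"
    and "\<kappa> = nat \<lfloor>Q / \<mu>\<rfloor>" and "\<alpha> = Q / (\<mu> * real \<kappa>)"
  shows "1 \<le> \<alpha> \<and> \<alpha> < 2 \<and>
    (AE \<omega> in M.
       ereal (\<alpha> * (2 * \<mu> * d / Q))
         \<le> liminf (\<lambda>n. ereal (ecc_opt \<pi> M \<xi> Q \<kappa> (\<lambda>i. X i \<omega>) n / real n)) \<and>
       liminf (\<lambda>n. ereal (ecc_opt \<pi> M \<xi> Q \<kappa> (\<lambda>i. X i \<omega>) n / real n))
         \<le> limsup (\<lambda>n. ereal (ecc_opt \<pi> M \<xi> Q \<kappa> (\<lambda>i. X i \<omega>) n / real n)) \<and>
       limsup (\<lambda>n. ereal (ecc_opt \<pi> M \<xi> Q \<kappa> (\<lambda>i. X i \<omega>) n / real n))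
         \<le> ereal ((\<alpha> + 1) * (2 * \<mu> * d / Q)))"
proof -
  interpret prob_space M by fact
  note R = assms(2) and dom = assms(3) and depot = assms(4) and indep = assms(5) and distr = assms(6)
  have r: "Q / \<mu> \<ge> 1" using \<open>\<mu> > 0\<close> \<open>\<mu> \<le> Q\<close> by simp
  have \<kappa>: "\<kappa> \<ge> 1" using r unfolding \<open>\<kappa> = nat \<lfloor>Q / \<mu>\<rfloor>\<close> by linarith
  have \<kappa>_le: "real \<kappa> \<le> Q / \<mu>" and \<kappa>_gt: "Q / \<mu> < real \<kappa> + 1"
    using r unfolding \<open>\<kappa> = nat \<lfloor>Q / \<mu>\<rfloor>\<close> by linarith+
  have \<alpha>: "\<alpha> = (Q / \<mu>) / real \<kappa>" using \<open>\<alpha> = Q / (\<mu> * real \<kappa>)\<close> by simp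
  \<comment> \<open>The upper bound comes from
    \<open>Q / \<mu> < real \<kappa> + 1 \<le> 2 * real \<kappa>\<close>.\<close>
  have \<alpha>_bounds: "1 \<le> \<alpha>" "\<alpha> < 2"
    unfolding \<alpha> using \<kappa>_le \<kappa>_gt \<kappa> by (subst pos_le_divide_eq pos_divide_less_eq; simp)+
  \<comment> \<open>Since \<open>\<alpha> * \<mu> / Q = 1 / real \<kappa>\<close>, the term with
    \<open>\<alpha>\<close> is the cost of travel to the cells; the additional 1 stands for the
    recourse.\<close>
  have lower: "\<alpha> * (2 * \<mu> * d / Q) = 2 / real \<kappa> * d"
    and upper: "(\<alpha> + 1) * (2 * \<mu> * d / Q) = (2 / real \<kappa> + 2 * \<mu> / Q) * d"
    unfolding \<alpha> using \<open>Q > 0\<close> \<open>\<mu> > 0\<close> \<kappa> by (simp_all add: field_simps)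
  have pair: "(\<lambda>\<omega>. (X i \<omega>, \<xi> i \<omega>)) \<in> borel_measurable M" if "i \<ge> 1" for i
    using indep that by (auto simp: indep_vars_def)
  have norm_fst: "(\<lambda>z :: (real ^ 2) \<times> real. norm (fst z)) \<in> borel_measurable borel"
    by (intro borel_measurable_continuous_onI continuous_intros)
  have snd: "(snd :: (real ^ 2) \<times> real \<Rightarrow> real) \<in> borel_measurable borel"
    by (intro borel_measurable_continuous_onI continuous_intros)
  have \<xi>_meas: "\<xi> i \<in> borel_measurable M" if "i \<ge> 1" for i
    using measurable_compose[OF pair[OF that] snd] by simp
  have \<xi>_distr: "distr M borel (\<xi> i) = distr M borel (\<xi> 1)" if "i \<ge> 1" for i
    using distr_compose_eq[OF distr[OF that] pair[OF that] pair snd] by simp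
  have \<xi>_int: "integrable M (\<xi> i)" and \<xi>_mean: "expectation (\<xi> i) = \<mu>" if "i \<ge> 1" for i
    using same_distr_real[OF \<xi>_distr[OF that] \<xi>_meas[OF that] \<xi>_meas] assms(8,9) by auto
  obtain b where b: "b > 0" "\<And>y. y \<in> R \<Longrightarrow> norm y \<le> b"
    using compact_imp_bounded[OF R] by (auto simp: bounded_pos)
  have "AE \<omega> in M. (\<lambda>n. (\<Sum>i\<in>{1..n}. norm (X i \<omega>)) / real n) \<longlonglongrightarrow> expectation (\<lambda>\<omega>. norm (X 1 \<omega>))"
  proof (rule strong_law_bounded)
    show "indep_vars (\<lambda>_. borel) (\<lambda>i \<omega>. norm (X i \<omega>)) {1..}"
      using indep_vars_compose2[OF indep, of "\<lambda>_ z. norm (fst z)" "\<lambda>_. borel"] norm_fst by simp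
    show "distr M borel (\<lambda>\<omega>. norm (X i \<omega>)) = distr M borel (\<lambda>\<omega>. norm (X 1 \<omega>))" if "i \<ge> 1" for i
      using distr_compose_eq[OF distr[OF that] pair[OF that] pair norm_fst] by simp
    show "norm (X 1 \<omega>) \<in> {0..b}" if "\<omega> \<in> space M" for \<omega>
      using b dom[of 1 \<omega>] that by simp
  qed (rule b)
  \<comment> \<open>Membership in \<open>space M\<close> is recorded because the assumptions on the
    locations are stated there.\<close>
  then have "AE \<omega> in M. \<omega> \<in> space M \<and> (\<lambda>n. (\<Sum>i\<in>{1..n}. norm (X i \<omega>)) / real n) \<longlonglongrightarrow> d"
    unfolding assms(12) by (rule AE_conjI[OF AE_space])
  then have "AE \<omega> in M.
       ereal (\<alpha> * (2 * \<mu> * d / Q))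
         \<le> liminf (\<lambda>n. ereal (ecc_opt \<pi> M \<xi> Q \<kappa> (\<lambda>i. X i \<omega>) n / real n)) \<and>
       liminf (\<lambda>n. ereal (ecc_opt \<pi> M \<xi> Q \<kappa> (\<lambda>i. X i \<omega>) n / real n))
         \<le> limsup (\<lambda>n. ereal (ecc_opt \<pi> M \<xi> Q \<kappa> (\<lambda>i. X i \<omega>) n / real n)) \<and>
       limsup (\<lambda>n. ereal (ecc_opt \<pi> M \<xi> Q \<kappa> (\<lambda>i. X i \<omega>) n / real n))
         \<le> ereal ((\<alpha> + 1) * (2 * \<mu> * d / Q))"
  proof eventually_elim
    case (elim \<omega>)
    \<comment> \<open>With \<open>\<omega>\<close> fixed, the locations are constants while the
      demands are still integrated over all of \<open>M\<close>, so the bounds for fixed locations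
      apply pathwise.\<close>
    have "ereal (2 / real \<kappa> * d) \<le> liminf (\<lambda>n. ereal (ecc_opt \<pi> M \<xi> Q \<kappa> (\<lambda>i. X i \<omega>) n / real n))"
      "limsup (\<lambda>n. ereal (ecc_opt \<pi> M \<xi> Q \<kappa> (\<lambda>i. X i \<omega>) n / real n)) \<le> ereal ((2 / real \<kappa> + 2 * \<mu> / Q) * d)"
      using elim R dom depot \<open>Q > 0\<close> \<open>\<mu> > 0\<close> \<kappa> \<xi>_int \<xi>_mean
      by (intro ecc_opt_liminf_limsup[of Q \<kappa> "\<lambda>i. X i \<omega>" \<xi> \<mu> R d \<pi>]; simp)+
    then show ?case
      unfolding lower upper by (simp add: Liminf_le_Limsup)
  qed
  with \<alpha>_bounds show ?thesis by blast
qed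

end
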